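(* Consider the first-order multiagent system $\dot x=-Lx+Bu$, $y=Hx$ on a directed weighted graph with $n$ nodes, leader set $\mathcal{V}_L$ and target set $\mathcal{V}_T$ with $p$ elements, and suppose the pair $(-L,B)$ is not completely controllable. Let $\hat x=Px$ be a controllability decomposition, with $HP^{-1}=[\hat H_c,\hat H_{\bar c}]$ partitioned conformally with the controllable and uncontrollable parts. Then the system is target controllable if and only if $\operatorname{rank}\hat H_c=p$.
   Context: Graph: $\mathcal{G}$ is a simple directed weighted graph (no self-loops, no multiple edges) with nodes $v_1,\dots,v_n$; $a_{ij}=w_{ij}$ is the weight of the edge from $v_j$ to $v_i$ if it exists ($i\neq j$), and $a_{ij}=0$ otherwise. The Laplacian $L=[l_{ij}]$ has $l_{ii}=\sum_{k\neq i}a_{ik}$ and $l_{ij}=-a_{ij}$ for $i\ne j$. System: leader set $\mathcal{V}_L=\{v_1,\dots,v_l\}$, target set $\mathcal{V}_T=\{\bar v_1,\dots,\bar v_p\}\subseteq\mathcal{V}$; $B=[e_{v_1},\dots,e_{v_l}]\in\mathbb{R}^{n\times l}$, $H=[e_{\bar v_1},\dots,e_{\bar v_p}]^T\in\mathbb{R}^{p\times n}$, with $e_i$ the standard basis vector indexed by the node. The system is target controllable if for any initial state $x(t_0)\in\mathbb{R}^n$ and any $y_f\in\mathbb{R}^p$ there is a control input $u$ with $y(t_f)=y_f$ ($t_0<t_f$ finite); equivalently $[HB,H(-L)B,\dots,H(-L)^{n-1}B]$ has rank $p$. Controllability decomposition: $P$ is a nonsingular matrix such that $$P(-L)P^{-1}=\begin{bmatrix}\hat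 L_c&\hat L_{12}\\0&\hat L_{\bar c}\end{bmatrix},\qquad PB=\begin{bmatrix}\hat B_c\\0\end{bmatrix},\qquad HP^{-1}=[\hat H_c,\hat H_{\bar c}],$$ with $\hat L_c\in\mathbb{R}^{\kappa\times\kappa}$, $\hat H_c\in\mathbb{R}^{p\times\kappa}$ and the pair $(\hat L_c,\hat B_c)$ controllable (so $\kappa=\operatorname{rank}[B,(-L)B,\dots,(-L)^{n-1}B]<n$). *)

theory Defs
  imports "HOL-Analysis.Analysis"
begin

section \<open>Weighted directed graphs\<close>

text \<open>
  The nodes are the elements of the finite index type. A pair \<open>(j, i) \<in> E\<close> is an edge
  from \<open>j\<close> to \<open>i\<close>, and \<open>w i j\<close> is its weight; values of \<open>w\<close> off the edge set are irrelevant.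
  As \<open>E\<close> is a set there are no multiple edges, and \<open>irrefl E\<close> excludes self-loops.
\<close>

definition adjacency :: "('n \<times> 'n) set \<Rightarrow> ('n \<Rightarrow> 'n \<Rightarrow> real) \<Rightarrow> real^'n^'n" where
  "adjacency E w = (\<chi> i j. if (j, i) \<in> E then w i j else 0)"

definition laplacian :: "('n::finite \<times> 'n) set \<Rightarrow> ('n \<Rightarrow> 'n \<Rightarrow> real) \<Rightarrow> real^'n^'n" where
  "laplacian E w =
     (\<chi> i j. if i = j then (\<Sum>k\<in>UNIV - {i}. adjacency E w $ i $ k)
             else - (adjacency E w $ i $ j))"

text \<open>
  \<open>leader j\<close> is the \<open>j\<close>-th leader and \<open>target k\<close> the \<open>k\<close>-th target. The columns of the input
  matrix and the rows of the output matrix are the corresponding standard basis vectors.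
\<close>

definition input_matrix :: "('l \<Rightarrow> 'n) \<Rightarrow> real^'l^'n" where
  "input_matrix leader = transpose (\<chi> j. axis (leader j) 1)"

definition output_matrix :: "('p \<Rightarrow> 'n) \<Rightarrow> real^'n^'p" where
  "output_matrix target = (\<chi> k. axis (target k) 1)"

section \<open>Linear systems and controllability\<close>

text \<open>
  Solutions of \<open>x' = A x + B u\<close> on \<open>[t\<^sub>0, t\<^sub>f]\<close> for Lebesgue integrable inputs, in the sense of
  Caratheodory: the differential equation is written in integrated form, which makes \<open>x\<close>
  continuous on the interval, and differentiable with the expected derivative wherever \<open>u\<close>
  is continuous.
\<close>

definition trajectory ::
  "real^'n^'n \<Rightarrow> real^'l^'n \<Rightarrow> real \<Rightarrow> real \<Rightarrow> (real \<Rightarrow> real^'l) \<Rightarrow> (real \<Rightarrow> real^'n) \<Rightarrow> bool" where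
  "trajectory A B t\<^sub>0 t\<^sub>f u x \<longleftrightarrow>
     u absolutely_integrable_on {t\<^sub>0..t\<^sub>f} \<and>
     (\<forall>t\<in>{t\<^sub>0..t\<^sub>f}. ((\<lambda>s. A *v x s + B *v u s) has_integral (x t - x t\<^sub>0)) {t\<^sub>0..t})"

definition completely_controllable :: "real^'n^'n \<Rightarrow> real^'l^'n \<Rightarrow> bool" where
  "completely_controllable A B \<longleftrightarrow>
     (\<forall>t\<^sub>0 x\<^sub>0 x\<^sub>f. \<exists>t\<^sub>f>t\<^sub>0. \<exists>u x. trajectory A B t\<^sub>0 t\<^sub>f u x \<and> x t\<^sub>0 = x\<^sub>0 \<and> x t\<^sub>f = x\<^sub>f)"

definition target_controllable :: "real^'n^'n \<Rightarrow> real^'l^'n \<Rightarrow> real^'n^'p \<Rightarrow> bool" where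
  "target_controllable A B H \<longleftrightarrow>
     (\<forall>t\<^sub>0 x\<^sub>0 y\<^sub>f. \<exists>t\<^sub>f>t\<^sub>0. \<exists>u x. trajectory A B t\<^sub>0 t\<^sub>f u x \<and> x t\<^sub>0 = x\<^sub>0 \<and> H *v x t\<^sub>f = y\<^sub>f)"

section \<open>Block matrices and the controllability decomposition\<close>

text \<open>
  Blocks are indexed by sum types, \<open>Inl\<close> giving the first block. In particular the transformed
  state lives in the space indexed by \<open>'k + 'm\<close>, with \<open>CARD('k)\<close> the dimension of the
  controllable part.
\<close>

definition block_matrix ::
  "'a^'k^'r \<Rightarrow> 'a^'m^'r \<Rightarrow> 'a^'k^'s \<Rightarrow> 'a^'m^'s \<Rightarrow> 'a^('k + 'm)^('r + 's)" where
  "block_matrix M11 M12 M21 M22 =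
     (\<chi> i j. case i of
        Inl r \<Rightarrow> (case j of Inl k \<Rightarrow> M11 $ r $ k | Inr m \<Rightarrow> M12 $ r $ m)
      | Inr s \<Rightarrow> (case j of Inl k \<Rightarrow> M21 $ s $ k | Inr m \<Rightarrow> M22 $ s $ m))"

definition block_column :: "'a^'c^'r \<Rightarrow> 'a^'c^'s \<Rightarrow> 'a^'c^('r + 's)" where
  "block_column M1 M2 = (\<chi> i j. case i of Inl r \<Rightarrow> M1 $ r $ j | Inr s \<Rightarrow> M2 $ s $ j)"

definition block_row :: "'a^'k^'r \<Rightarrow> 'a^'m^'r \<Rightarrow> 'a^('k + 'm)^'r" where
  "block_row M1 M2 = (\<chi> i j. case j of Inl k \<Rightarrow> M1 $ i $ k | Inr m \<Rightarrow> M2 $ i $ m)"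

text \<open>
  \<open>invertible P\<close> asks for a two-sided inverse and so forces \<open>CARD('n) = CARD('k) + CARD('m)\<close>.
  Since index types are nonempty, \<open>0 < CARD('k) < CARD('n)\<close>.
\<close>

definition controllability_decomposition ::
  "real^'n^'n \<Rightarrow> real^'l^'n \<Rightarrow> real^'n^'p \<Rightarrow> real^'n^('k + 'm) \<Rightarrow>
   real^'k^'k \<Rightarrow> real^'m^'k \<Rightarrow> real^'m^'m \<Rightarrow> real^'l^'k \<Rightarrow> real^'k^'p \<Rightarrow> real^'m^'p \<Rightarrow> bool" where
  "controllability_decomposition A B H P A\<^sub>c A\<^sub>1\<^sub>2 A\<^sub>u B\<^sub>c H\<^sub>c H\<^sub>u \<longleftrightarrow>
     invertible P \<and>
     P ** A ** matrix_inv P = block_matrix A\<^sub>c A\<^sub>1\<^sub>2 0 A\<^sub>u \<and>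
     P ** B = block_column B\<^sub>c 0 \<and>
     H ** matrix_inv P = block_row H\<^sub>c H\<^sub>u \<and>
     completely_controllable A\<^sub>c B\<^sub>c"

end

theory Submission
  imports Defs
begin

text \<open>
  Two intertwining matrices do all the work. The columns of \<open>P\<inverse>\<close> belonging to the first
  block form a matrix \<open>J\<close> that maps trajectories of \<open>(A\<^sub>c, B\<^sub>c)\<close> to trajectories of \<open>(A, B)\<close>, with
  \<open>H J = H\<^sub>c\<close>; the rows of \<open>P\<close> belonging to the second block form a matrix \<open>Q\<close> that maps
  trajectories of \<open>(A, B)\<close> to unforced trajectories of \<open>A\<^sub>u\<close>.

  If the system is target controllable, then starting from \<open>x\<^sub>0 = 0\<close> we have \<open>Q x = 0\<close> at all times,
  so every output lies in the range of \<open>H\<^sub>c\<close>. Conversely, if \<open>H\<^sub>c\<close> is surjective, any output is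
  reached by adding to the unforced trajectory from \<open>x\<^sub>0\<close> the \<open>J\<close>-image of a trajectory of the
  controllable part. The final time in \<open>completely_controllable\<close> may depend on the final state,
  whereas the output of the unforced trajectory depends on the final time, so a time that serves
  all final states is needed first. States that can be steered to \<open>0\<close> by time \<open>T\<close> form a
  subspace increasing with \<open>T\<close>, which is therefore the whole space for some \<open>T\<close>.
\<close>

section \<open>Existence of solutions of linear differential equations\<close>

text \<open>The solution is the exponential \<open>exp ((t - T) A) v\<close>, built componentwise as
  a real power series so that termwise differentiation applies. Since \<open>T\<close> is arbitrary,
  it can serve as an initial or as a final time.\<close>

lemma linear_ode_solution:
  fixes A :: "real^'n::finite^'n" and v :: "real^'n"
  obtains z where "z T = v" "\<And>t. (z has_vector_derivative A *v z t) (at t)"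
proof -
  define p where "p n = (((*v) A) ^^ n) v" for n
  have p_Suc: "p (Suc n) = A *v p n" for n by (simp add: p_def)
  obtain K where K: "K > 0" "\<And>x. norm (A *v x) \<le> norm x * K"
    using bounded_linear.pos_bounded[OF matrix_vector_mul_bounded_linear[of A]] by blast
  have norm_p: "norm (p n) \<le> K ^ n * norm v" for n
  proof (induction n)
    case 0
    show ?case by (simp add: p_def)
  next
    case (Suc n)
    have "norm (p (Suc n)) \<le> norm (p n) * K" using K(2) by (simp add: p_Suc)
    also have "\<dots> \<le> K ^ n * norm v * K" using Suc K(1) by (intro mult_right_mono) auto
    finally show ?case by (simp add: algebra_simps)
  qed
  define c where "c i n = p n $ i / fact n" for i n
  \<comment> \<open>Since \<open>p n\<close> is \<open>A\<close> applied \<open>n\<close> times to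
    \<open>v\<close>, the series is dominated by that of
    \<open>norm v * exp (K * \<bar>y\<bar>)\<close>, which converges for every
    \<open>y\<close>.\<close>
  have summable: "summable (\<lambda>n. c i n * y ^ n)" for i and y :: real
  proof (rule summable_comparison_test)
    show "summable (\<lambda>n. norm v * (inverse (fact n) * (K * \<bar>y\<bar>) ^ n))"
      by (intro summable_mult summable_exp)
    have "\<bar>p n $ i\<bar> \<le> K ^ n * norm v" for n
      using component_le_norm_cart[of "p n" i] norm_p[of n] by linarith
    then have "\<bar>p n $ i\<bar> * \<bar>y\<bar> ^ n \<le> K ^ n * norm v * \<bar>y\<bar> ^ n" for n
      by (intro mult_right_mono) auto
    then show "\<exists>N. \<forall>n\<ge>N. norm (c i n * y ^ n) \<le> norm v * (inverse (fact n) * (K * \<bar>y\<bar>) ^ n)"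
      by (simp add: c_def abs_mult power_abs power_mult_distrib divide_simps algebra_simps)
  qed
  define f where "f i t = (\<Sum>n. c i n * t ^ n)" for i and t :: real
  \<comment> \<open>Differentiation shifts the coefficients: the factor \<open>n + 1\<close> turns
    \<open>p (Suc n) / fact (Suc n)\<close> into \<open>A *v p n / fact n\<close>, so the derived
    series is \<open>A\<close> applied to the original one.\<close>
  have diffs_c: "diffs (c i) n = (\<Sum>j\<in>UNIV. A $ i $ j * c j n)" for i n
    by (simp add: diffs_def c_def p_Suc matrix_vector_mult_def flip: sum_divide_distrib
        del: of_nat_Suc)
  have f_deriv: "(f i has_field_derivative (\<Sum>j\<in>UNIV. A $ i $ j * f j t)) (at t)" for i t
  proof -
    have "(f i has_field_derivative (\<Sum>n. diffs (c i) n * t ^ n)) (at t)"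
      unfolding f_def by (rule termdiffs_strong_converges_everywhere[OF summable])
    also have "(\<Sum>n. diffs (c i) n * t ^ n) = (\<Sum>n. \<Sum>j\<in>UNIV. A $ i $ j * (c j n * t ^ n))"
      by (simp add: diffs_c sum_distrib_right mult.assoc)
    also have "\<dots> = (\<Sum>j\<in>UNIV. A $ i $ j * f j t)"
      unfolding f_def by (subst suminf_sum) (auto intro: summable_mult summable simp: suminf_mult summable)
    finally show ?thesis .
  qed
  define z where "z t = (\<chi> i. f i (t - T))" for t
  have "f i 0 = v $ i" for i
    unfolding f_def powser_zero by (simp add: c_def p_def)
  then have "z T = v"
    by (simp add: z_def vec_eq_iff)
  moreover have "(z has_vector_derivative A *v z t) (at t)" for t
  proof -
    have "((\<lambda>t. f i (t - T)) has_field_derivative (A *v z t) $ i) (at t)" for i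
      using f_deriv[of i "t - T"] DERIV_shift[of "f i" _ t "- T"]
      by (simp add: matrix_vector_mult_def z_def)
    then have "\<forall>i\<in>Basis. ((\<lambda>t. z t \<bullet> i) has_vector_derivative (A *v z t) \<bullet> i) (at t)"
      by (auto simp: Basis_vec_def inner_axis z_def has_real_derivative_iff_has_vector_derivative)
    then show ?thesis
      unfolding has_vector_derivative_def
      by (subst has_derivative_componentwise_within) auto
  qed
  ultimately show thesis by (rule that)
qed

section \<open>Operations on trajectories, and uniqueness for unforced systems\<close>

text \<open>A linear map commutes with the integral, and the two matrix identities move
  \<open>M\<close> past \<open>A\<close> and \<open>B\<close>. The input stays the same.\<close>

lemma trajectory_intertwine:
  fixes A :: "real^'n::finite^'n" and B :: "real^'l::finite^'n"
    and A' :: "real^'m::finite^'m" and B' :: "real^'l^'m" and M :: "real^'n^'m"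
  assumes x: "trajectory A B t\<^sub>0 t\<^sub>f u x" and A: "M ** A = A' ** M" and B: "M ** B = B'"
  shows "trajectory A' B' t\<^sub>0 t\<^sub>f u (\<lambda>t. M *v x t)"
proof -
  have "((\<lambda>s. A' *v (M *v x s) + B' *v u s) has_integral (M *v x t - M *v x t\<^sub>0)) {t\<^sub>0..t}"
    if "t \<in> {t\<^sub>0..t\<^sub>f}" for t
  proof -
    have "((*v) M \<circ> (\<lambda>s. A *v x s + B *v u s) has_integral (M *v (x t - x t\<^sub>0))) {t\<^sub>0..t}"
      using x that by (intro has_integral_linear) (auto simp: trajectory_def)
    moreover have "(*v) M \<circ> (\<lambda>s. A *v x s + B *v u s) = (\<lambda>s. A' *v (M *v x s) + B' *v u s)"
      by (auto simp: fun_eq_iff matrix_vector_right_distrib matrix_vector_mul_assoc A B)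
    ultimately show ?thesis by (simp add: matrix_vector_mult_diff_distrib)
  qed
  then show ?thesis using x by (simp add: trajectory_def)
qed

lemma trajectory_add:
  assumes "trajectory A B t\<^sub>0 t\<^sub>f u x" and "trajectory A B t\<^sub>0 t\<^sub>f u' x'"
  shows "trajectory A B t\<^sub>0 t\<^sub>f (\<lambda>t. u t + u' t) (\<lambda>t. x t + x' t)"
proof -
  have "((\<lambda>s. A *v (x s + x' s) + B *v (u s + u' s)) has_integral
      (x t + x' t - (x t\<^sub>0 + x' t\<^sub>0))) {t\<^sub>0..t}" if "t \<in> {t\<^sub>0..t\<^sub>f}" for t
  proof -
    have "((\<lambda>s. (A *v x s + B *v u s) + (A *v x' s + B *v u' s)) has_integral
        (x t - x t\<^sub>0) + (x' t - x' t\<^sub>0)) {t\<^sub>0..t}"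
      using assms that by (intro has_integral_add) (auto simp: trajectory_def)
    then show ?thesis by (simp add: algebra_simps matrix_vector_right_distrib)
  qed
  then show ?thesis using assms by (auto simp: trajectory_def set_integral_add)
qed

lemma trajectory_scaleR:
  assumes "trajectory A B t\<^sub>0 t\<^sub>f u x"
  shows "trajectory A B t\<^sub>0 t\<^sub>f (\<lambda>t. c *\<^sub>R u t) (\<lambda>t. c *\<^sub>R x t)"
proof -
  have "((\<lambda>s. A *v (c *\<^sub>R x s) + B *v (c *\<^sub>R u s)) has_integral (c *\<^sub>R x t - c *\<^sub>R x t\<^sub>0)) {t\<^sub>0..t}"
    if "t \<in> {t\<^sub>0..t\<^sub>f}" for t
  proof -
    have "((\<lambda>s. c *\<^sub>R (A *v x s + B *v u s)) has_integral c *\<^sub>R (x t - x t\<^sub>0)) {t\<^sub>0..t}"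
      using assms that by (intro has_integral_cmul) (auto simp: trajectory_def)
    then show ?thesis by (simp add: algebra_simps)
  qed
  then show ?thesis using assms by (auto simp: trajectory_def)
qed

lemma trajectory_zero: "trajectory A B t\<^sub>0 t\<^sub>f (\<lambda>t. 0) (\<lambda>t. 0)"
  by (simp add: trajectory_def)

lemma trajectory_unforced:
  fixes A :: "real^'n::finite^'n"
  assumes "\<And>t. (x has_vector_derivative A *v x t) (at t)"
  shows "trajectory A B t\<^sub>0 t\<^sub>f (\<lambda>t. 0) x"
  using assms
  by (auto simp: trajectory_def has_vector_derivative_at_within
      intro!: fundamental_theorem_of_calculus)

text \<open>The origin is an equilibrium when the input vanishes, so a state once steered to 0 can
  be kept there for any further time.\<close>

lemma trajectory_extend_by_zero:
  fixes A :: "real^'n::finite^'n" and B :: "real^'l::finite^'n"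
  assumes x: "trajectory A B t\<^sub>0 t\<^sub>1 u x" and "x t\<^sub>1 = 0" and le: "t\<^sub>0 \<le> t\<^sub>1" "t\<^sub>1 \<le> t\<^sub>2"
  shows "trajectory A B t\<^sub>0 t\<^sub>2 (\<lambda>t. if t \<le> t\<^sub>1 then u t else 0) (\<lambda>t. if t \<le> t\<^sub>1 then x t else 0)"
    (is "trajectory A B t\<^sub>0 t\<^sub>2 ?u ?x")
proof -
  have "?u absolutely_integrable_on {t\<^sub>0..t\<^sub>1}"
    using x by (auto simp: trajectory_def intro: absolutely_integrable_spike[where S = "{}"])
  \<comment> \<open>At the junction \<open>t\<^sub>1\<close> the input still has the value
    \<open>u t\<^sub>1\<close>; a single point is negligible.\<close>
  moreover have "?u absolutely_integrable_on {t\<^sub>1..t\<^sub>2}"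
    by (rule absolutely_integrable_spike[where S = "{t\<^sub>1}" and f = "\<lambda>t. 0"]) auto
  ultimately have "?u absolutely_integrable_on {t\<^sub>0..t\<^sub>2}"
    using le by (rule absolutely_integrable_on_combine)
  moreover have "((\<lambda>s. A *v ?x s + B *v ?u s) has_integral (?x t - ?x t\<^sub>0)) {t\<^sub>0..t}"
    if t: "t \<in> {t\<^sub>0..t\<^sub>2}" for t
  proof -
    have before: "((\<lambda>s. A *v ?x s + B *v ?u s) has_integral (x s - x t\<^sub>0)) {t\<^sub>0..s}"
      if "s \<in> {t\<^sub>0..t\<^sub>1}" for s
    proof (rule has_integral_eq)
      show "((\<lambda>s. A *v x s + B *v u s) has_integral (x s - x t\<^sub>0)) {t\<^sub>0..s}"
        using x that by (simp add: trajectory_def)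
    qed (use that in auto)
    show ?thesis
    proof (cases "t \<le> t\<^sub>1")
      case True
      then show ?thesis using before[of t] t le by simp
    next
      case False
      have "((\<lambda>s. A *v ?x s + B *v ?u s) has_integral 0) {t\<^sub>1..t}"
        by (rule has_integral_spike_finite[where S = "{t\<^sub>1}" and f = "\<lambda>s. 0"]) auto
      then show ?thesis
        using has_integral_combine[OF le(1) _ before[of t\<^sub>1], of t 0] False le \<open>x t\<^sub>1 = 0\<close> by simp
    qed
  qed
  ultimately show ?thesis by (simp add: trajectory_def)
qed


text \<open>
  The inner product of \<open>x\<close> with a solution of the adjoint equation is constant; choosing the
  solution that agrees with \<open>x\<close> at \<open>t\<^sub>f\<close> spares Gronwall's inequality.
\<close>

lemma trajectory_no_input_zero:
  fixes A :: "real^'n::finite^'n" and u :: "real \<Rightarrow> real^'l::finite"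
  assumes x: "trajectory A 0 t\<^sub>0 t\<^sub>f u x" and "x t\<^sub>0 = 0" and "t\<^sub>0 \<le> t\<^sub>f"
  shows "x t\<^sub>f = 0"
proof -
  have int: "((\<lambda>s. A *v x s) has_integral x t) {t\<^sub>0..t}" if "t \<in> {t\<^sub>0..t\<^sub>f}" for t
    using x that \<open>x t\<^sub>0 = 0\<close> by (auto simp: trajectory_def)
  then have x_eq: "x t = integral {t\<^sub>0..t} (\<lambda>s. A *v x s)" if "t \<in> {t\<^sub>0..t\<^sub>f}" for t
    using integral_unique[OF int[OF that]] by simp
  \<comment> \<open>Bootstrapping: as an indefinite integral, \<open>x\<close> is continuous; hence
    the integrand \<open>A *v x s\<close> is continuous, and \<open>x\<close> is differentiable in
    the classical sense.\<close>
  have "continuous_on {t\<^sub>0..t\<^sub>f} (\<lambda>t. integral {t\<^sub>0..t} (\<lambda>s. A *v x s))"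
    using int[of t\<^sub>f] \<open>t\<^sub>0 \<le> t\<^sub>f\<close> by (intro indefinite_integral_continuous_1) auto
  then have "continuous_on {t\<^sub>0..t\<^sub>f} x"
    by (rule continuous_on_eq) (simp add: x_eq)
  then have cont: "continuous_on {t\<^sub>0..t\<^sub>f} (\<lambda>s. A *v x s)"
    by (rule bounded_linear.continuous_on[OF matrix_vector_mul_bounded_linear])
  have deriv: "(x has_vector_derivative A *v x t) (at t within {t\<^sub>0..t\<^sub>f})" if "t \<in> {t\<^sub>0..t\<^sub>f}" for t
    using integral_has_vector_derivative[OF cont that]
    by (rule has_vector_derivative_transform[OF that, rotated]) (simp add: x_eq)
  obtain g where g: "g t\<^sub>f = x t\<^sub>f" "\<And>t. (g has_vector_derivative - transpose A *v g t) (at t)"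
    using linear_ode_solution[of t\<^sub>f "x t\<^sub>f" "- transpose A"] by blast
  have adj: "(- transpose A *v y) \<bullet> z + y \<bullet> (A *v z) = 0" for y z
  proof -
    have "- transpose A *v y = - (y v* A)"
      by (simp add: matrix_vector_mult_def vector_matrix_mult_def transpose_def vec_eq_iff sum_negf
          mult.commute)
    then show ?thesis by (simp add: dot_lmul_matrix)
  qed
  have "((\<lambda>t. g t \<bullet> x t) has_derivative (\<lambda>h. 0)) (at t within {t\<^sub>0..t\<^sub>f})"
    if "t \<in> {t\<^sub>0..t\<^sub>f}" for t
  proof -
    have "((\<lambda>t. g t \<bullet> x t) has_derivative
        (\<lambda>h. g t \<bullet> (h *\<^sub>R (A *v x t)) + (h *\<^sub>R (- transpose A *v g t)) \<bullet> x t))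
        (at t within {t\<^sub>0..t\<^sub>f})"
      using has_vector_derivative_at_within[OF g(2)] deriv[OF that]
      unfolding has_vector_derivative_def by (rule has_derivative_inner)
    moreover have "g t \<bullet> (h *\<^sub>R (A *v x t)) + (h *\<^sub>R (- transpose A *v g t)) \<bullet> x t = 0" for h
    proof -
      have "g t \<bullet> (h *\<^sub>R (A *v x t)) + (h *\<^sub>R (- transpose A *v g t)) \<bullet> x t
          = h * ((- transpose A *v g t) \<bullet> x t + g t \<bullet> (A *v x t))"
        by (simp add: algebra_simps)
      then show ?thesis by (simp only: adj mult_zero_right)
    qed
    ultimately show ?thesis by simp
  qed
  \<comment> \<open>The left side is the squared norm of \<open>x t\<^sub>f\<close>, and the right
    side is 0.\<close>
  then have "g t\<^sub>f \<bullet> x t\<^sub>f = g t\<^sub>0 \<bullet> x t\<^sub>0"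
    using \<open>t\<^sub>0 \<le> t\<^sub>f\<close> by (intro has_derivative_zero_unique[where s = "{t\<^sub>0..t\<^sub>f}"]) auto
  then show ?thesis using g(1) \<open>x t\<^sub>0 = 0\<close> by simp
qed

section \<open>Steering times independent of the state\<close>

text \<open>Steering to 0 is treated first because such trajectories can be prolonged by resting at
  0; a trajectory that reaches another state need not be able to stay there.\<close>

lemma null_controllable_uniform_time:
  fixes A :: "real^'n::finite^'n" and B :: "real^'l::finite^'n"
  assumes "completely_controllable A B"
  obtains T where "T > t\<^sub>0" "\<And>v. \<exists>u x. trajectory A B t\<^sub>0 T u x \<and> x t\<^sub>0 = v \<and> x T = 0"
proof -
  define S where "S T = {v. \<exists>u x. trajectory A B t\<^sub>0 T u x \<and> x t\<^sub>0 = v \<and> x T = 0}" for T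
  have "\<exists>t>t\<^sub>0. v \<in> S t" for v
    using assms unfolding completely_controllable_def S_def by blast
  then obtain \<tau> where \<tau>: "\<And>v. \<tau> v > t\<^sub>0" "\<And>v. v \<in> S (\<tau> v)" by metis
  \<comment> \<open>The latest of the times chosen for the basis vectors serves them all, and
    linearity extends this to their span.\<close>
  define T where "T = Max (\<tau> ` Basis)"
  have \<tau>_le: "\<tau> b \<le> T" if "b \<in> Basis" for b using that by (simp add: T_def)
  have "T > t\<^sub>0"
    using \<tau>(1) \<tau>_le SOME_Basis by (meson less_le_trans)
  have "Basis \<subseteq> S T"
  proof
    fix b :: "real^'n" assume "b \<in> Basis"
    obtain u x where "trajectory A B t\<^sub>0 (\<tau> b) u x" "x t\<^sub>0 = b" "x (\<tau> b) = 0"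
      using \<tau>(2)[of b] unfolding S_def by blast
    then show "b \<in> S T"
      using trajectory_extend_by_zero[of A B t\<^sub>0 "\<tau> b" u x T] \<tau>(1)[of b] \<tau>_le[OF \<open>b \<in> Basis\<close>]
      by (fastforce simp: S_def)
  qed
  moreover have "subspace (S T)"
  proof (rule subspaceI)
    show "0 \<in> S T"
      using trajectory_zero[of A B t\<^sub>0 T] by (auto simp: S_def)
  next
    fix v v' assume "v \<in> S T" "v' \<in> S T"
    then obtain u x u' x' where
      "trajectory A B t\<^sub>0 T u x" "x t\<^sub>0 = v" "x T = 0"
      "trajectory A B t\<^sub>0 T u' x'" "x' t\<^sub>0 = v'" "x' T = 0"
      unfolding S_def by blast
    then show "v + v' \<in> S T"
      unfolding S_def
      by (intro CollectI exI[of _ "\<lambda>t. u t + u' t"] exI[of _ "\<lambda>t. x t + x' t"])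
        (simp add: trajectory_add)
  next
    fix c v assume "v \<in> S T"
    then obtain u x where "trajectory A B t\<^sub>0 T u x" "x t\<^sub>0 = v" "x T = 0"
      unfolding S_def by blast
    then show "c *\<^sub>R v \<in> S T"
      unfolding S_def
      by (intro CollectI exI[of _ "\<lambda>t. c *\<^sub>R u t"] exI[of _ "\<lambda>t. c *\<^sub>R x t"])
        (simp add: trajectory_scaleR)
  qed
  ultimately have "span Basis \<subseteq> S T" by (rule span_minimal)
  then show thesis using that[OF \<open>T > t\<^sub>0\<close>] by (auto simp: S_def)
qed

lemma reachable_uniform_time:
  fixes A :: "real^'n::finite^'n" and B :: "real^'l::finite^'n"
  assumes "completely_controllable A B"
  obtains T where "T > t\<^sub>0" "\<And>v. \<exists>u x. trajectory A B t\<^sub>0 T u x \<and> x t\<^sub>0 = 0 \<and> x T = v"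
proof -
  obtain T where T: "T > t\<^sub>0"
    "\<And>v. \<exists>u x. trajectory A B t\<^sub>0 T u x \<and> x t\<^sub>0 = v \<and> x T = 0"
    using null_controllable_uniform_time[OF assms] by blast
  have "\<exists>u x. trajectory A B t\<^sub>0 T u x \<and> x t\<^sub>0 = 0 \<and> x T = v" for v
  proof -
    \<comment> \<open>Let \<open>z\<close> be the unforced solution that ends in \<open>v\<close>.
      Adding a trajectory that steers \<open>- z t\<^sub>0\<close> to 0 cancels the start of
      \<open>z\<close> and leaves its end unchanged.\<close>
    obtain z where z: "z T = v" "\<And>t. (z has_vector_derivative A *v z t) (at t)"
      using linear_ode_solution by blast
    obtain u x where x: "trajectory A B t\<^sub>0 T u x" "x t\<^sub>0 = - z t\<^sub>0" "x T = 0"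
      using T(2) by blast
    show ?thesis
      using trajectory_add[OF trajectory_unforced[OF z(2)] x(1)] x z(1) by force
  qed
  with T(1) show thesis by (rule that)
qed

section \<open>Block matrix algebra\<close>

lemma sum_UNIV_Plus:
  fixes f :: "'a::finite + 'b::finite \<Rightarrow> 'c::comm_monoid_add"
  shows "sum f UNIV = (\<Sum>i\<in>UNIV. f (Inl i)) + (\<Sum>j\<in>UNIV. f (Inr j))"
  by (subst UNIV_Plus_UNIV[symmetric], subst sum.Plus) auto

lemma block_matrix_mult_block_column:
  fixes M11 :: "'a::semiring_1^'k::finite^'r::finite" and M12 :: "'a^'m::finite^'r"
    and M21 :: "'a^'k^'s::finite" and M22 :: "'a^'m^'s" and X :: "'a^'c::finite^'k" and Y :: "'a^'c^'m"
  shows "block_matrix M11 M12 M21 M22 ** block_column X Y =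
    block_column (M11 ** X + M12 ** Y) (M21 ** X + M22 ** Y)"
  by (simp add: block_matrix_def block_column_def matrix_matrix_mult_def vec_eq_iff sum_UNIV_Plus
      split: sum.split)

lemma block_row_mult_block_matrix:
  fixes M11 :: "'a::semiring_1^'k::finite^'r::finite" and M12 :: "'a^'m::finite^'r"
    and M21 :: "'a^'k^'s::finite" and M22 :: "'a^'m^'s" and X :: "'a^'r^'c::finite" and Y :: "'a^'s^'c"
  shows "block_row X Y ** block_matrix M11 M12 M21 M22 =
    block_row (X ** M11 + Y ** M21) (X ** M12 + Y ** M22)"
  by (simp add: block_matrix_def block_row_def matrix_matrix_mult_def vec_eq_iff sum_UNIV_Plus
      split: sum.split)

lemma block_row_mult_block_column:
  fixes X :: "'a::semiring_1^'r::finite^'c::finite" and Y :: "'a^'s::finite^'c"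
    and X' :: "'a^'d::finite^'r" and Y' :: "'a^'d^'s"
  shows "block_row X Y ** block_column X' Y' = X ** X' + Y ** Y'"
  by (simp add: block_row_def block_column_def matrix_matrix_mult_def vec_eq_iff sum_UNIV_Plus)

lemma block_column_mult:
  fixes X :: "'a::semiring_1^'c::finite^'r::finite" and Y :: "'a^'c^'s::finite" and M :: "'a^'d::finite^'c"
  shows "block_column X Y ** M = block_column (X ** M) (Y ** M)"
  by (simp add: block_column_def matrix_matrix_mult_def vec_eq_iff split: sum.split)

lemma mult_block_row:
  fixes X :: "'a::semiring_1^'k::finite^'r::finite" and Y :: "'a^'m::finite^'r" and M :: "'a^'r^'d::finite"
  shows "M ** block_row X Y = block_row (M ** X) (M ** Y)"
  by (simp add: block_row_def matrix_matrix_mult_def vec_eq_iff split: sum.split)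

lemma block_row_add:
  "block_row X Y + block_row X' Y' = block_row (X + X') (Y + Y')"
  by (simp add: block_row_def vec_eq_iff split: sum.split)

lemma matrix_add_mult_distrib:
  fixes X Y :: "'a::semiring_1^'n::finite^'m"
  shows "(X + Y) ** M = X ** M + Y ** M"
  by (simp add: matrix_matrix_mult_def vec_eq_iff algebra_simps sum.distrib)

lemma matrix_mult_zero_left [simp]: "(0 :: 'a::semiring_1^'n::finite^'m) ** M = 0"
  by (simp add: matrix_matrix_mult_def vec_eq_iff)

lemma matrix_mult_zero_right [simp]: "M ** (0 :: 'a::semiring_1^'m^'n::finite) = 0"
  by (simp add: matrix_matrix_mult_def vec_eq_iff)

section \<open>The rank criterion\<close>

lemma target_controllable_iff_rank:
  fixes A :: "real^'n::finite^'n" and B :: "real^'l::finite^'n" and H :: "real^'n^'p::finite"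
    and P :: "real^'n^('k::finite + 'm::finite)"
  assumes "controllability_decomposition A B H P A\<^sub>c A\<^sub>1\<^sub>2 A\<^sub>u B\<^sub>c H\<^sub>c H\<^sub>u"
  shows "target_controllable A B H \<longleftrightarrow> rank H\<^sub>c = CARD('p)"
proof -
  define P' where "P' = matrix_inv P"
  define J where "J = P' ** block_column (mat 1) 0"
  define Q where "Q = block_row 0 (mat 1) ** P"
  \<comment> \<open>\<open>R\<close> and \<open>Q\<close> extract the controllable and
    uncontrollable coordinates of a state, which splits the output into \<open>H\<^sub>c\<close> and
    \<open>H\<^sub>u\<close> parts.\<close>
  define R where "R = block_row (mat 1) 0 ** P"
  have inv: "P ** P' = mat 1" "P' ** P = mat 1"
    using assms unfolding controllability_decomposition_def P'_def
    by (auto simp: matrix_inv_def invertible_def intro: someI2_ex)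
  have PA: "P ** A ** P' = block_matrix A\<^sub>c A\<^sub>1\<^sub>2 0 A\<^sub>u"
    and PB: "P ** B = block_column B\<^sub>c 0" and HP: "H ** P' = block_row H\<^sub>c H\<^sub>u"
    and cc: "completely_controllable A\<^sub>c B\<^sub>c"
    using assms by (auto simp: controllability_decomposition_def P'_def)
  have A_P': "A ** P' = P' ** block_matrix A\<^sub>c A\<^sub>1\<^sub>2 0 A\<^sub>u"
    by (metis PA inv(2) matrix_mul_assoc matrix_mul_lid)
  have P_A: "P ** A = block_matrix A\<^sub>c A\<^sub>1\<^sub>2 0 A\<^sub>u ** P"
    by (metis PA inv(2) matrix_mul_assoc matrix_mul_rid)
  \<comment> \<open>The zero lower-left block makes the range of \<open>J\<close> invariant under
    \<open>A\<close>.\<close>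
  have J_A: "J ** A\<^sub>c = A ** J"
    by (simp add: J_def matrix_mul_assoc A_P')
      (simp add: block_matrix_mult_block_column block_column_mult flip: matrix_mul_assoc)
  have J_B: "J ** B\<^sub>c = B"
  proof -
    have "J ** B\<^sub>c = P' ** (P ** B)"
      by (simp add: J_def PB block_column_mult flip: matrix_mul_assoc)
    then show ?thesis by (simp add: matrix_mul_assoc inv)
  qed
  have H_J: "H ** J = H\<^sub>c"
    by (simp add: J_def matrix_mul_assoc HP block_row_mult_block_column)
  \<comment> \<open>By the same zero block, the uncontrollable coordinates evolve independently of
    the controllable ones.\<close>
  have Q_A: "Q ** A = A\<^sub>u ** Q"
    by (simp add: Q_def P_A block_row_mult_block_matrix mult_block_row matrix_mul_assoc
        flip: matrix_mul_assoc[of _ P A])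
  have Q_B: "Q ** B = 0"
    by (simp add: Q_def PB block_row_mult_block_column flip: matrix_mul_assoc)
  have H_eq: "H = H\<^sub>c ** R + H\<^sub>u ** Q"
  proof -
    have "H = block_row H\<^sub>c H\<^sub>u ** P"
      by (metis HP inv(2) matrix_mul_assoc matrix_mul_rid)
    also have "block_row H\<^sub>c H\<^sub>u = H\<^sub>c ** block_row (mat 1) 0 + H\<^sub>u ** block_row 0 (mat 1)"
      by (simp add: mult_block_row block_row_add)
    finally show ?thesis by (simp add: R_def Q_def matrix_add_mult_distrib matrix_mul_assoc)
  qed
  show ?thesis
    unfolding full_rank_surjective
  proof
    assume ctrl: "target_controllable A B H"
    show "surj ((*v) H\<^sub>c)"
      unfolding surj_def
    proof
      fix y
      obtain t\<^sub>f u x where "t\<^sub>f > (0::real)" and x: "trajectory A B 0 t\<^sub>f u x" "x 0 = 0" "H *v x t\<^sub>f = y"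
        using ctrl unfolding target_controllable_def by blast
      have "Q *v x t\<^sub>f = 0"
        using trajectory_no_input_zero[OF trajectory_intertwine[OF x(1) Q_A Q_B]] x(2) \<open>t\<^sub>f > 0\<close>
        by simp
      \<comment> \<open>The preimage is \<open>R *v x t\<^sub>f\<close>, as the
        \<open>H\<^sub>u\<close> part of the output vanishes.\<close>
      then show "\<exists>v. y = H\<^sub>c *v v"
        using x(3) unfolding H_eq
        by (metis add.right_neutral matrix_vector_mul_assoc matrix_vector_mult_0_right
            matrix_vector_mult_add_rdistrib)
    qed
  next
    assume surj: "surj ((*v) H\<^sub>c)"
    show "target_controllable A B H"
      unfolding target_controllable_def
    proof (intro allI)
      fix t\<^sub>0 :: real and x\<^sub>0 y\<^sub>f
      \<comment> \<open>\<open>T\<close> has to be fixed before \<open>v\<close>, because the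
        \<open>v\<close> chosen below depends on \<open>z T\<close>.\<close>
      obtain T where T: "T > t\<^sub>0"
        "\<And>v. \<exists>u x. trajectory A\<^sub>c B\<^sub>c t\<^sub>0 T u x \<and> x t\<^sub>0 = 0 \<and> x T = v"
        using reachable_uniform_time[OF cc] by blast
      obtain z where z: "z t\<^sub>0 = x\<^sub>0" "\<And>t. (z has_vector_derivative A *v z t) (at t)"
        using linear_ode_solution by blast
      obtain v where v: "H\<^sub>c *v v = y\<^sub>f - H *v z T"
        using surj by (metis surjD)
      obtain u x where x: "trajectory A\<^sub>c B\<^sub>c t\<^sub>0 T u x" "x t\<^sub>0 = 0" "x T = v"
        using T(2) by blast
      have "trajectory A B t\<^sub>0 T (\<lambda>t. 0 + u t) (\<lambda>t. z t + J *v x t)"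
        by (intro trajectory_add trajectory_unforced z(2) trajectory_intertwine[OF x(1) J_A J_B])
      moreover have "H *v (z T + J *v x T) = y\<^sub>f"
        by (simp add: matrix_vector_right_distrib matrix_vector_mul_assoc H_J x v)
      ultimately show "\<exists>t\<^sub>f>t\<^sub>0. \<exists>u x. trajectory A B t\<^sub>0 t\<^sub>f u x \<and> x t\<^sub>0 = x\<^sub>0 \<and> H *v x t\<^sub>f = y\<^sub>f"
        using T(1) z(1) x(2) by (intro exI[of _ T] exI conjI) auto
    qed
  qed
qed

theorem lemma4:
  fixes E :: "('n::finite \<times> 'n) set"
    and w :: "'n \<Rightarrow> 'n \<Rightarrow> real"
    and leader :: "'l::finite \<Rightarrow> 'n"
    and target :: "'p::finite \<Rightarrow> 'n"
    and P :: "real^'n^('k::finite + 'm::finite)"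
    and L\<^sub>c :: "real^'k^'k" and L\<^sub>1\<^sub>2 :: "real^'m^'k" and L\<^sub>u :: "real^'m^'m"
    and B\<^sub>c :: "real^'l^'k" and H\<^sub>c :: "real^'k^'p" and H\<^sub>u :: "real^'m^'p"
  assumes "irrefl E"
    and "inj leader"
    and "inj target"
    and "\<not> completely_controllable (- laplacian E w) (input_matrix leader)"
    and "controllability_decomposition (- laplacian E w) (input_matrix leader)
           (output_matrix target) P L\<^sub>c L\<^sub>1\<^sub>2 L\<^sub>u B\<^sub>c H\<^sub>c H\<^sub>u"
  shows "target_controllable (- laplacian E w) (input_matrix leader) (output_matrix target)
           \<longleftrightarrow> rank H\<^sub>c = CARD('p)"
  using assms(5) by (rule target_controllable_iff_rank)

end
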